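(* Let $\Gamma$ be the game over simplices defined in the context. For all sufficiently small $\tau>0$ (i.e. there is $\tau_0>0$, depending on the game, such that the following holds for every $\tau\in(0,\tau_0)$), the set $\mathcal{S}^{\tau}$ of common stationary points of the functions $l_{i,j}^{\tau}$, $i\in[N]$, $j\in[n_i]$, on $\hat{\Delta}^{\tau}$ is nonempty and equals the set of Nash equilibria of the game $\Gamma^{\tau,t}$.
   Context: Write $[N]=\{1,\dots,N\}$ and let $n_i\ge 1$ be integers. The game $\Gamma$ has $N$ players. Player $i$ has action set the simplex $\Delta_i=\{x_i=(x_i^1,\dots,x_i^{n_i+1})\in\mathbb{R}_+^{n_i+1}:\sum_{j=1}^{n_i+1}x_i^j=1\}$, and $\Delta=\Delta_1\times\dots\times\Delta_N$. Player $i$ maximizes the utility $f_i:\Delta\to\mathbb{R}$, $f_i(x)=\sum_{k\ne i}x_i^TQ_{ik}x_k+\sum_{j=1}^N r_j^Tx_j$, where $Q_{ik}$ are arbitrary real $(n_i+1)\times(n_k+1)$ matrices and $r_j\in\mathbb{R}^{n_j+1}$. A Nash equilibrium of a game with action sets $A_i$ and utilities $g_i$ is a joint action $x^*\in\prod_i A_i$ with $g_i(x_i^*,x_{-i}^* )\ge g_i(x_i,x_{-i}^* )$ for all $i$ and all $x_i\in A_i$, where $x_{-i}$ denotes the actions of all players other than $i$. Transformed regularized game: $\Delta_i^t=\{x_i=(x_i^1,\dots,x_i^{n_i})\in\mathbb{R}_+^{n_i}:\sum_{j=1}^{n_i}x_i^j\le 1\}$, $\Delta^t=\prod_{i=1}^N\Delta_i^t$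 (the superscript $t$ stands for "transformed"). For $x\in\Delta^t$, $f_i^t(x)$ is the value of $f_i$ at the lift of $x$ to $\Delta$, obtained by setting $x_k^{n_k+1}=1-\sum_{j=1}^{n_k}x_k^j$ for all $k\in[N]$. For $\tau>0$ the game $\Gamma^{\tau,t}$ has action sets $\Delta_i^t$ and utilities (with $0\ln 0=0$) $$f_i^{\tau,t}(x)=f_i^t(x)-\tau\sum_{j=1}^{n_i}x_i^j\ln(x_i^j)-\tau\Big(1-\sum_{j=1}^{n_i}x_i^j\Big)\ln\Big(1-\sum_{j=1}^{n_i}x_i^j\Big).$$ Since $f_i$ is affine in each $x_k$ and has no quadratic term in $x_i$, one has $\frac{\partial f_i^t}{\partial x_i^j}(x)=\hat r_i^j+\sum_{k\ne i}\langle\hat q_{ik}^j,x_k\rangle$ for constants $\hat r_i^j\in\mathbb{R}$ and vectors $\hat q_{ik}^j\in\mathbb{R}^{n_k}$ determined by the game. For $i\in[N]$, $j\in[n_i]$ define $$l_{i,j}^{\tau}(x)=\Big(\frac{\partial f_i^{\tau,t}}{\partial x_i^j}(x)\Big)^2=\Big(\hat r_i^j+\sum_{k\ne i}\langle\hat q_{ik}^j,x_k\rangle-\tau\ln x_i^j+\tau\ln\big(1-\sum_{\ell=1}^{n_i}x_i^\ell\big)\Big)^2.$$ With $M=\max_{i\in[N]}(n_i+1)$, let $\hat{\Delta}^{\tau}=\prod_{i=1}^N\hat{\Delta}_i^{\tau}$, where $$\hat{\Delta}_i^{\tau}=\Big\{x_i\in\mathbb{R}^{n_i}: x_i^j\ge\frac{e^{-1/\tau^2}}{M}\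 \forall j\in[n_i],\ \ \sum_{j=1}^{n_i}x_i^j\le 1-\frac{e^{-1/\tau^{1.5}}}{M}\Big\}.$$ The set of stationary points of $l_{i,j}^{\tau}$ on $\hat{\Delta}^{\tau}$ is $\mathcal{S}_{i,j}^{\tau}=\{x\in\hat{\Delta}^{\tau}:\langle\nabla l_{i,j}^{\tau}(x),y-x\rangle\ge 0\text{ for all }y\in\hat{\Delta}^{\tau}\}$, where $\nabla$ is the full gradient with respect to $x\in\mathbb{R}^{\sum_i n_i}$, and $\mathcal{S}^{\tau}=\bigcap_{i=1}^N\bigcap_{j=1}^{n_i}\mathcal{S}_{i,j}^{\tau}$. *)

theory Defs
  imports "HOL-Analysis.Analysis"
begin

text \<open>
  Players are numbered \<open>1..N\<close>; coordinates of a vector of length \<open>m\<close> are numbered \<open>1..m\<close>.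
  Vectors and joint actions are extensional functions (\<^const>\<open>undefined\<close> outside their
  index sets), so that equality of functions is equality of vectors.
  A matrix \<open>Q i k\<close> is given by its entries \<open>Q i k a b\<close>; only those with
  \<open>1 \<le> a \<le> n i + 1\<close> and \<open>1 \<le> b \<le> n k + 1\<close> are ever used.
\<close>

type_synonym joint_action = "nat \<Rightarrow> nat \<Rightarrow> real"

definition nash_equilibria ::
    "nat \<Rightarrow> (nat \<Rightarrow> 'a set) \<Rightarrow> (nat \<Rightarrow> (nat \<Rightarrow> 'a) \<Rightarrow> real) \<Rightarrow> (nat \<Rightarrow> 'a) set" where
  "nash_equilibria N A g =
     {x \<in> PiE {1..N} A. \<forall>i\<in>{1..N}. \<forall>y\<in>A i. g i x \<ge> g i (x(i := y))}"

definition simplex_actions :: "(nat \<Rightarrow> nat) \<Rightarrow> nat \<Rightarrow> (nat \<Rightarrow> real) set" where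
  "simplex_actions n i =
     {v \<in> extensional {1..n i + 1}. (\<forall>j\<in>{1..n i + 1}. v j \<ge> 0) \<and> (\<Sum>j=1..n i + 1. v j) = 1}"

definition utility ::
    "nat \<Rightarrow> (nat \<Rightarrow> nat) \<Rightarrow> (nat \<Rightarrow> nat \<Rightarrow> nat \<Rightarrow> nat \<Rightarrow> real) \<Rightarrow> (nat \<Rightarrow> nat \<Rightarrow> real)
      \<Rightarrow> nat \<Rightarrow> joint_action \<Rightarrow> real" where
  "utility N n Q r i x =
     (\<Sum>k\<in>{1..N} - {i}. \<Sum>a=1..n i + 1. \<Sum>b=1..n k + 1. x i a * Q i k a b * x k b)
     + (\<Sum>j=1..N. \<Sum>a=1..n j + 1. r j a * x j a)"

definition transformed_actions :: "(nat \<Rightarrow> nat) \<Rightarrow> nat \<Rightarrow> (nat \<Rightarrow> real) set" where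
  "transformed_actions n i =
     {v \<in> extensional {1..n i}. (\<forall>j\<in>{1..n i}. v j \<ge> 0) \<and> (\<Sum>j=1..n i. v j) \<le> 1}"

definition lift_action :: "nat \<Rightarrow> (nat \<Rightarrow> nat) \<Rightarrow> joint_action \<Rightarrow> joint_action" where
  "lift_action N n x = (\<lambda>k\<in>{1..N}. (x k)(n k + 1 := 1 - (\<Sum>j=1..n k. x k j)))"

lemma lift_action_in_simplex:
  assumes "x \<in> PiE {1..N} (transformed_actions n)"
  shows "lift_action N n x \<in> PiE {1..N} (simplex_actions n)"
proof (rule PiE_I)
  fix k assume k: "k \<in> {1..N}"
  have x: "x k \<in> transformed_actions n k"
    using assms k by (rule PiE_mem)
  have "(\<Sum>j=1..n k. ((x k)(n k + 1 := 1 - (\<Sum>j=1..n k. x k j))) j) = (\<Sum>j=1..n k. x k j)"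
    by (rule sum.cong) auto
  then have "(\<Sum>j=1..n k + 1. lift_action N n x k j) = 1"
    using k by (simp add: lift_action_def)
  moreover have "lift_action N n x k \<in> extensional {1..n k + 1}"
    using x k by (auto simp: lift_action_def transformed_actions_def extensional_def)
  moreover have "lift_action N n x k j \<ge> 0" if "j \<in> {1..n k + 1}" for j
    using x k that by (auto simp: lift_action_def transformed_actions_def)
  ultimately show "lift_action N n x k \<in> simplex_actions n k"
    by (simp add: simplex_actions_def)
qed (auto simp: lift_action_def)

text \<open>The convention \<open>0 ln 0 = 0\<close> holds automatically, by the factor in front of \<^const>\<open>ln\<close>.\<close>

definition reg_utility ::
    "nat \<Rightarrow> (nat \<Rightarrow> nat) \<Rightarrow> (nat \<Rightarrow> nat \<Rightarrow> nat \<Rightarrow> nat \<Rightarrow> real) \<Rightarrow> (nat \<Rightarrow> nat \<Rightarrow> real)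
      \<Rightarrow> real \<Rightarrow> nat \<Rightarrow> joint_action \<Rightarrow> real" where
  "reg_utility N n Q r \<tau> i x =
     utility N n Q r i (lift_action N n x)
     - \<tau> * (\<Sum>j=1..n i. x i j * ln (x i j))
     - \<tau> * ((1 - (\<Sum>j=1..n i. x i j)) * ln (1 - (\<Sum>j=1..n i. x i j)))"

definition partial_deriv ::
    "nat \<Rightarrow> nat \<Rightarrow> (joint_action \<Rightarrow> real) \<Rightarrow> joint_action \<Rightarrow> real" where
  "partial_deriv k m g x = deriv (\<lambda>t. g (x(k := (x k)(m := t)))) (x k m)"

definition loss ::
    "nat \<Rightarrow> (nat \<Rightarrow> nat) \<Rightarrow> (nat \<Rightarrow> nat \<Rightarrow> nat \<Rightarrow> nat \<Rightarrow> real) \<Rightarrow> (nat \<Rightarrow> nat \<Rightarrow> real)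
      \<Rightarrow> real \<Rightarrow> nat \<Rightarrow> nat \<Rightarrow> joint_action \<Rightarrow> real" where
  "loss N n Q r \<tau> i j x = (partial_deriv i j (reg_utility N n Q r \<tau> i) x)\<^sup>2"

definition restricted_actions :: "nat \<Rightarrow> (nat \<Rightarrow> nat) \<Rightarrow> real \<Rightarrow> nat \<Rightarrow> (nat \<Rightarrow> real) set" where
  "restricted_actions N n \<tau> i =
     (let M = real (MAX k\<in>{1..N}. n k + 1) in
      {v \<in> extensional {1..n i}.
         (\<forall>j\<in>{1..n i}. v j \<ge> exp (- 1 / \<tau>\<^sup>2) / M) \<and>
         (\<Sum>j=1..n i. v j) \<le> 1 - exp (- 1 / \<tau> powr (3 / 2)) / M})"

text \<open>
  For \<open>\<tau> > 0\<close> the restricted actions have strictly positive entries with sum strictly below 1,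
  so near every point of their product the losses are smooth and the vector of partial
  derivatives is the full gradient in all coordinates of all players.
\<close>

definition stationary_points ::
    "nat \<Rightarrow> (nat \<Rightarrow> nat) \<Rightarrow> joint_action set \<Rightarrow> (joint_action \<Rightarrow> real) \<Rightarrow> joint_action set" where
  "stationary_points N n X g =
     {x \<in> X. \<forall>y\<in>X. (\<Sum>k=1..N. \<Sum>m=1..n k. partial_deriv k m g x * (y k m - x k m)) \<ge> 0}"

definition common_stationary_points ::
    "nat \<Rightarrow> (nat \<Rightarrow> nat) \<Rightarrow> (nat \<Rightarrow> nat \<Rightarrow> nat \<Rightarrow> nat \<Rightarrow> real) \<Rightarrow> (nat \<Rightarrow> nat \<Rightarrow> real)
      \<Rightarrow> real \<Rightarrow> joint_action set" where
  "common_stationary_points N n Q r \<tau> =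
     (\<Inter>i\<in>{1..N}. \<Inter>j\<in>{1..n i}.
        stationary_points N n (PiE {1..N} (restricted_actions N n \<tau>)) (loss N n Q r \<tau> i j))"

end

theory Submission imports Defs begin

text \<open>
  Write \<open>s\<^sub>i = 1 - \<Sum>\<^sub>j x\<^sub>i\<^sup>j\<close> for the weight of the eliminated coordinate. The own partial derivative of a
  regularized utility is the \<open>score\<close> \<open>g\<^sub>i\<^sub>j = c\<^sub>i\<^sub>j - \<tau> ln x\<^sub>i\<^sup>j + \<tau> ln s\<^sub>i\<close>, where \<open>c\<^sub>i\<^sub>j\<close>
  (the \<open>marginal\<close>) depends on the other players only and is bounded by some \<open>C\<close> on the whole
  space of joint actions. The loss is \<open>g\<^sub>i\<^sub>j\<^sup>2\<close>, and both sets of the theorem turn out to be the set of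
  interior joint actions at which all scores vanish.

  Equilibria. Against fixed opponents the utility is affine plus entropy, so by Gibbs' inequality the
  unique best response is the logit distribution with log-odds \<open>c\<^sub>i\<^sub>j / \<tau>\<close>
  (\<open>best_response_iff_logit\<close>), and being this distribution means exactly that the scores
  are zero (\<open>logit_iff_score_zero\<close>). Brouwer's theorem applied to the logit map gives an
  equilibrium (\<open>exists_logit_fixed_point\<close>). Since \<open>\<bar>c\<^sub>i\<^sub>j\<bar> \<le> C\<close>, all weights of a logit
  distribution are at least of order \<open>exp (- 2 C / \<tau>)\<close>, and that of the eliminated coordinate at least of
  order \<open>exp (- C / \<tau>)\<close>; for small \<open>\<tau>\<close> these exceed the floors
  \<open>exp (- 1 / \<tau>\<^sup>2)\<close> and \<open>exp (- 1 / \<tau> powr (3/2))\<close> that define the restricted actions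
  (\<open>logit_action_restricted\<close>). The gradient \<open>2 g\<^sub>i\<^sub>j \<nabla>g\<^sub>i\<^sub>j\<close> of each loss is zero
  there, so equilibria are common stationary points.

  Stationary points. Varying player \<open>i\<close> alone, stationarity of the loss \<open>i, j\<close> at \<open>x\<close> says that \<open>x\<^sub>i\<close>
  maximizes \<open>g\<^sub>i\<^sub>j (y\<^sup>j / x\<^sub>i\<^sup>j + (\<Sum>\<^sub>m y\<^sup>m) / s\<^sub>i)\<close>, a linear function of \<open>y\<close>, over the
  restricted actions. If \<open>g\<^sub>i\<^sub>j > 0\<close>, all coefficients are positive and \<open>x\<^sub>i\<close> puts as much weight as
  possible on \<open>j\<close>: \<open>s\<^sub>i\<close> sits at its floor, and then \<open>\<tau> ln s\<^sub>i\<close> is about \<open>- 1 / sqrt \<tau>\<close>, which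
  drives \<open>g\<^sub>i\<^sub>j\<close> below zero. If \<open>g\<^sub>i\<^sub>j < 0\<close>, every \<open>x\<^sub>i\<^sup>m\<close> sits at its floor, and then
  \<open>- \<tau> ln x\<^sub>i\<^sup>j\<close> is about \<open>1 / \<tau>\<close>, which drives \<open>g\<^sub>i\<^sub>j\<close> above zero. Hence
  \<open>g\<^sub>i\<^sub>j = 0\<close> (\<open>stationary_score_zero\<close>). In both corners the other logarithm is harmless, because the floors are so small that the
  remaining weight, \<open>x\<^sub>i\<^sup>j\<close> or \<open>s\<^sub>i\<close>, is at least one half.
\<close>

section \<open>Brouwer's theorem on finite-dimensional cubes\<close>

text \<open>
  Elements of the cube are extensional, so it is a product over the whole index type with
  singleton factors outside \<open>I\<close>, and Tychonoff's theorem applies.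
\<close>

lemma compact_unit_cube:
  fixes I :: "'i set"
  shows "compact (PiE I (\<lambda>_. {0..1::real}))"
proof -
  define S where "S = (\<lambda>i. if i \<in> I then {0..1::real} else {undefined})"
  have "compactin (product_topology (\<lambda>_. euclidean) UNIV) (PiE UNIV S)"
    by (subst compactin_PiE) (auto simp: S_def)
  moreover have "PiE UNIV S = PiE I (\<lambda>_. {0..1})"
    by (auto simp: S_def PiE_def Pi_def extensional_def split: if_splits)
  ultimately show ?thesis
    by (simp add: euclidean_product_topology)
qed

lemma tendsto_fun_coordinate:
  fixes X :: "nat \<Rightarrow> 'i \<Rightarrow> real"
  assumes "X \<longlonglongrightarrow> x"
  shows "(\<lambda>m. X m i) \<longlonglongrightarrow> x i"
proof -
  have "limitin (product_topology (\<lambda>_. euclidean) UNIV) X x sequentially"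
    using assms by (simp add: euclidean_product_topology)
  then show ?thesis by (simp add: limitin_componentwise)
qed

lemma tendsto_fun_coordinatewise:
  fixes X :: "nat \<Rightarrow> 'i \<Rightarrow> real"
  assumes "\<And>i. (\<lambda>m. X m i) \<longlonglongrightarrow> x i"
  shows "X \<longlonglongrightarrow> x"
proof -
  have "limitin (product_topology (\<lambda>_. euclidean) UNIV) X x sequentially"
    using assms by (simp add: limitin_componentwise)
  then show ?thesis by (simp add: euclidean_product_topology)
qed

text \<open>
  The combinatorial half of Brouwer's theorem, obtained from Kuhn's labelling lemma on the grid
  of mesh \<open>1 / p\<close>: near \<open>z\<close>, every coordinate of \<open>f u - u\<close> changes sign. The index set is
  transported to an initial segment of the naturals, on which Kuhn's lemma is formulated.
\<close>

lemma sperner_cube_cell: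
  fixes I :: "'i set" and f :: "('i \<Rightarrow> real) \<Rightarrow> 'i \<Rightarrow> real" and p :: nat
  defines "C \<equiv> PiE I (\<lambda>_. {0..1::real})"
  assumes "finite I" "p > 0"
    and maps: "\<And>x i. x \<in> C \<Longrightarrow> i \<in> I \<Longrightarrow> f x i \<in> {0..1}"
  shows "\<exists>z\<in>C. \<forall>i\<in>I. \<exists>u\<in>C. \<exists>v\<in>C.
           (\<forall>j\<in>I. \<bar>u j - z j\<bar> \<le> 1 / real p) \<and> (\<forall>j\<in>I. \<bar>v j - z j\<bar> \<le> 1 / real p) \<and>
           u i \<le> f u i \<and> f v i \<le> v i"
proof -
  define D where "D = card I"
  obtain h where h: "bij_betw h I {0..<D}"
    using ex_bij_betw_finite_nat[OF \<open>finite I\<close>] D_def by blast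
  have hI: "h i < D" if "i \<in> I" for i
    using h that by (auto simp: bij_betw_def)
  have hsurj: "\<exists>i\<in>I. h i = k" if "k < D" for k
    using h that by (metis atLeastLessThan_iff bij_betw_iff_bijections zero_le)
  define pt where "pt = (\<lambda>q::nat \<Rightarrow> nat. \<lambda>i\<in>I. real (q (h i)) / real p)"
  define g where "g = inv_into I h"
  have gh: "g (h i) = i" if "i \<in> I" for i
    using h that by (simp add: g_def bij_betw_def inv_into_f_f)
  have gI: "g k \<in> I" if "k < D" for k
    using hsurj[OF that] gh by auto
  have hg: "h (g k) = k" if "k < D" for k
    using hsurj[OF that] gh by auto
  have ptC: "pt q \<in> C" if "\<forall>k<D. q k \<le> p" for q
    using that hI \<open>p > 0\<close> by (auto simp: pt_def C_def divide_simps)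
  \<comment> \<open>Label 0 means that \<open>f\<close> does not decrease the coordinate. The test
    \<open>< 1\<close> forces label 1 on the upper face; the lower face gets label 0 because
    \<open>f\<close> maps into the cube.\<close>
  define label where "label = (\<lambda>q k. if pt q (g k) < 1 \<and> pt q (g k) \<le> f (pt q) (g k) then 0 else 1::nat)"
  have l0: "\<forall>q. (\<forall>k<D. q k \<le> p) \<longrightarrow> (\<forall>k<D. q k = 0 \<longrightarrow> label q k = 0)"
  proof (intro allI impI)
    fix q k assume q: "\<forall>k<D. q k \<le> p" and k: "k < D" "q k = 0"
    have "pt q (g k) = 0" using k gI hg by (simp add: pt_def)
    then show "label q k = 0"
      using maps[OF ptC[OF q] gI[OF k(1)]] by (simp add: label_def)
  qed
  have l1: "\<forall>q. (\<forall>k<D. q k \<le> p) \<longrightarrow> (\<forall>k<D. q k = p \<longrightarrow> label q k = 1)"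
  proof (intro allI impI)
    fix q k assume q: "\<forall>k<D. q k \<le> p" and k: "k < D" "q k = p"
    have "pt q (g k) = 1" using k gI hg \<open>p > 0\<close> by (simp add: pt_def)
    then show "label q k = 1" by (simp add: label_def)
  qed
  have l01: "\<forall>q. (\<forall>k<D. q k \<le> p) \<longrightarrow> (\<forall>k<D. label q k = 0 \<or> label q k = 1)"
    by (simp add: label_def)
  obtain q where q: "\<forall>k<D. q k < p"
    and cell: "\<forall>k<D. \<exists>r s. (\<forall>j<D. q j \<le> r j \<and> r j \<le> q j + 1) \<and>
                  (\<forall>j<D. q j \<le> s j \<and> s j \<le> q j + 1) \<and> label r k \<noteq> label s k"
    using kuhn_lemma[OF \<open>p > 0\<close> l01 l0 l1] by blast
  have near: "\<bar>pt r j - pt q j\<bar> \<le> 1 / real p" if "\<forall>k<D. q k \<le> r k \<and> r k \<le> q k + 1" "j \<in> I" for r j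
  proof -
    have "q (h j) \<le> r (h j)" "r (h j) \<le> q (h j) + 1"
      using that hI by auto
    then have "\<bar>real (r (h j)) - real (q (h j))\<bar> \<le> 1" by linarith
    then show ?thesis
      using that(2) \<open>p > 0\<close> by (simp add: pt_def divide_simps flip: diff_divide_distrib)
  qed
  have inC: "pt r \<in> C" if "\<forall>k<D. q k \<le> r k \<and> r k \<le> q k + 1" for r
  proof (rule ptC, intro allI impI)
    fix k assume "k < D"
    then show "r k \<le> p" using that q by (metis Suc_eq_plus1 Suc_leI le_trans)
  qed
  have up: "pt r (g k) \<le> f (pt r) (g k)" if "label r k = 0" for r k
    using that by (simp add: label_def split: if_splits)
  have down: "f (pt r) (g k) \<le> pt r (g k)"
    if "label r k \<noteq> 0" "\<forall>k<D. q k \<le> r k \<and> r k \<le> q k + 1" "k < D" for r k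
    using that(1) maps[OF inC[OF that(2)] gI[OF that(3)]] by (auto simp: label_def split: if_splits)
  show ?thesis
  proof (rule bexI, rule ballI)
    fix i assume i: "i \<in> I"
    obtain r s where r: "\<forall>j<D. q j \<le> r j \<and> r j \<le> q j + 1"
      and s: "\<forall>j<D. q j \<le> s j \<and> s j \<le> q j + 1" and ne: "label r (h i) \<noteq> label s (h i)"
      using cell hI[OF i] by blast
    \<comment> \<open>Swap the two corners if necessary, so that the first one carries label 0.\<close>
    have "\<exists>r s. (\<forall>j<D. q j \<le> r j \<and> r j \<le> q j + 1) \<and> (\<forall>j<D. q j \<le> s j \<and> s j \<le> q j + 1) \<and>
       label r (h i) = 0 \<and> label s (h i) \<noteq> 0" (is ?ex)
    proof (cases "label r (h i) = 0")
      case True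
      then show ?ex using r s ne by metis
    next
      case False
      then have "label s (h i) = 0" using ne by (simp add: label_def split: if_splits)
      then show ?ex using r s False by metis
    qed
    then obtain r s where rs: "\<forall>j<D. q j \<le> r j \<and> r j \<le> q j + 1"
       "\<forall>j<D. q j \<le> s j \<and> s j \<le> q j + 1" "label r (h i) = 0" "label s (h i) \<noteq> 0"
      by blast
    show "\<exists>u\<in>C. \<exists>v\<in>C.
           (\<forall>j\<in>I. \<bar>u j - pt q j\<bar> \<le> 1 / real p) \<and> (\<forall>j\<in>I. \<bar>v j - pt q j\<bar> \<le> 1 / real p) \<and>
           u i \<le> f u i \<and> f v i \<le> v i"
      using inC[OF rs(1)] inC[OF rs(2)] near[OF rs(1)] near[OF rs(2)]
        up[OF rs(3)] down[OF rs(4) rs(2) hI[OF i]] gh[OF i] by auto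
  next
    show "pt q \<in> C" using q by (intro ptC) auto
  qed
qed

text \<open>
  Brouwer's theorem for a cube whose dimension is a term rather than a type: the joint actions of
  a game live in a space of dimension \<open>\<Sum>\<^sub>i n i\<close>. A limit point of the cells of
  \<open>sperner_cube_cell\<close> for mesh tending to 0 is fixed, since in the limit both inequalities hold at
  the same point. Countability of the index type makes the product topology metrizable, so that
  compactness yields convergent subsequences.
\<close>

theorem brouwer_unit_cube:
  fixes I :: "'i::countable set" and f :: "('i \<Rightarrow> real) \<Rightarrow> 'i \<Rightarrow> real"
  defines "C \<equiv> PiE I (\<lambda>_. {0..1::real})"
  assumes "finite I"
    and maps: "\<And>x i. x \<in> C \<Longrightarrow> i \<in> I \<Longrightarrow> f x i \<in> {0..1}"
    and cont: "\<And>i. i \<in> I \<Longrightarrow> continuous_on C (\<lambda>x. f x i)"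
  shows "\<exists>x\<in>C. \<forall>i\<in>I. f x i = x i"
proof -
  have "\<exists>z\<in>C. \<forall>i\<in>I. \<exists>u\<in>C. \<exists>v\<in>C.
           (\<forall>j\<in>I. \<bar>u j - z j\<bar> \<le> 1 / real (Suc m)) \<and> (\<forall>j\<in>I. \<bar>v j - z j\<bar> \<le> 1 / real (Suc m)) \<and>
           u i \<le> f u i \<and> f v i \<le> v i" for m
    using sperner_cube_cell[OF \<open>finite I\<close>, of "Suc m" f] maps unfolding C_def by blast
  then obtain z where zC: "\<And>m. z m \<in> C"
    and z: "\<And>m. \<forall>i\<in>I. \<exists>u\<in>C. \<exists>v\<in>C. (\<forall>j\<in>I. \<bar>u j - z m j\<bar> \<le> 1 / real (Suc m)) \<and>
       (\<forall>j\<in>I. \<bar>v j - z m j\<bar> \<le> 1 / real (Suc m)) \<and> u i \<le> f u i \<and> f v i \<le> v i"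
    by metis
  obtain x \<sigma> where x: "x \<in> C" and \<sigma>: "strict_mono \<sigma>" and lim: "(z \<circ> \<sigma>) \<longlonglongrightarrow> x"
    using compact_unit_cube[of I] zC
    unfolding compact_eq_seq_compact_metric seq_compact_def C_def by meson
  \<comment> \<open>The corners of the cells shrink to the same limit as their base points.\<close>
  have close: "w \<longlonglongrightarrow> x"
    if wC: "\<And>m. w m \<in> C" and w: "\<And>m. \<forall>j\<in>I. \<bar>w m j - z (\<sigma> m) j\<bar> \<le> 1 / real (Suc (\<sigma> m))" for w
  proof (rule tendsto_fun_coordinatewise)
    fix j
    show "(\<lambda>m. w m j) \<longlonglongrightarrow> x j"
    proof (cases "j \<in> I")
      case True
      have "(\<lambda>m. 1 / real (Suc (\<sigma> m))) \<longlonglongrightarrow> 0"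
        using LIMSEQ_subseq_LIMSEQ[OF LIMSEQ_inverse_real_of_nat \<sigma>]
        by (simp add: o_def inverse_eq_divide)
      then have "(\<lambda>m. w m j - z (\<sigma> m) j) \<longlonglongrightarrow> 0"
        by (rule Lim_null_comparison[rotated]) (use w True in auto)
      from tendsto_add[OF this tendsto_fun_coordinate[OF lim, of j]] show ?thesis by simp
    next
      case False
      then have "w m j = undefined" "x j = undefined" for m
        using wC[of m] x by (auto simp: C_def PiE_def extensional_def)
      then show ?thesis by simp
    qed
  qed
  have "f x i = x i" if i: "i \<in> I" for i
  proof -
    have "\<forall>m. \<exists>u v. u \<in> C \<and> v \<in> C \<and> (\<forall>j\<in>I. \<bar>u j - z m j\<bar> \<le> 1 / real (Suc m)) \<and>
       (\<forall>j\<in>I. \<bar>v j - z m j\<bar> \<le> 1 / real (Suc m)) \<and> u i \<le> f u i \<and> f v i \<le> v i"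
      using z i by blast
    then obtain u v where uv: "\<And>m. u m \<in> C" "\<And>m. v m \<in> C"
        "\<And>m. \<forall>j\<in>I. \<bar>u m j - z m j\<bar> \<le> 1 / real (Suc m)"
        "\<And>m. \<forall>j\<in>I. \<bar>v m j - z m j\<bar> \<le> 1 / real (Suc m)"
        "\<And>m. u m i \<le> f (u m) i" "\<And>m. f (v m) i \<le> v m i"
      by metis
    have fw: "(\<lambda>m. f (w m) i) \<longlonglongrightarrow> f x i" if "\<And>m. w m \<in> C" "w \<longlonglongrightarrow> x" for w
      using cont[OF i] x that unfolding continuous_on_sequentially by (auto simp: o_def)
    have u: "(\<lambda>m. u (\<sigma> m)) \<longlonglongrightarrow> x" and v: "(\<lambda>m. v (\<sigma> m)) \<longlonglongrightarrow> x"
      using uv by (auto intro!: close)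
    have "x i \<le> f x i"
      using tendsto_fun_coordinate[OF u] fw[OF _ u] by (rule LIMSEQ_le) (use uv in auto)
    moreover have "f x i \<le> x i"
      using fw[OF _ v] tendsto_fun_coordinate[OF v] by (rule LIMSEQ_le) (use uv in auto)
    ultimately show ?thesis by simp
  qed
  then show ?thesis using x by blast
qed

section \<open>The utilities as functions of the own action\<close>

text \<open>
  The partial derivative of the unregularized transformed utility of player \<open>i\<close> in the own
  coordinate \<open>j\<close>. The differences arise because raising coordinate \<open>j\<close> lowers the eliminated
  coordinate \<open>n i + 1\<close> by the same amount.
\<close>

definition marginal ::
    "nat \<Rightarrow> (nat \<Rightarrow> nat) \<Rightarrow> (nat \<Rightarrow> nat \<Rightarrow> nat \<Rightarrow> nat \<Rightarrow> real) \<Rightarrow> (nat \<Rightarrow> nat \<Rightarrow> real)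
      \<Rightarrow> nat \<Rightarrow> nat \<Rightarrow> joint_action \<Rightarrow> real" where
  "marginal N n Q r i j x =
     r i j - r i (n i + 1)
     + (\<Sum>k\<in>{1..N} - {i}. \<Sum>b=1..n k + 1. (Q i k j b - Q i k (n i + 1) b) * lift_action N n x k b)"

definition slack :: "(nat \<Rightarrow> nat) \<Rightarrow> nat \<Rightarrow> joint_action \<Rightarrow> real" where
  "slack n i x = 1 - (\<Sum>j=1..n i. x i j)"

text \<open>
  The own partial derivative of the regularized utility, see \<open>partial_deriv_reg_utility\<close>.
\<close>

definition score ::
    "nat \<Rightarrow> (nat \<Rightarrow> nat) \<Rightarrow> (nat \<Rightarrow> nat \<Rightarrow> nat \<Rightarrow> nat \<Rightarrow> real) \<Rightarrow> (nat \<Rightarrow> nat \<Rightarrow> real)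
      \<Rightarrow> real \<Rightarrow> nat \<Rightarrow> nat \<Rightarrow> joint_action \<Rightarrow> real" where
  "score N n Q r \<tau> i j x = marginal N n Q r i j x - \<tau> * ln (x i j) + \<tau> * ln (slack n i x)"

definition interior_at :: "(nat \<Rightarrow> nat) \<Rightarrow> nat \<Rightarrow> joint_action \<Rightarrow> bool" where
  "interior_at n i x \<longleftrightarrow> (\<forall>j\<in>{1..n i}. x i j > 0) \<and> slack n i x > 0"

lemma lift_action_update_other:
  "k \<noteq> i \<Longrightarrow> lift_action N n (x(i := v)) k = lift_action N n x k"
  by (simp add: lift_action_def restrict_def)

lemma marginal_update_own: "marginal N n Q r i j (x(i := v)) = marginal N n Q r i j x"
  unfolding marginal_def
  by (intro arg_cong2[of _ _ _ _ "(+)"] sum.cong refl) (simp add: lift_action_update_other)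

lemma sum_lift_action:
  assumes "i \<in> {1..N}"
  shows "(\<Sum>a=1..n i + 1. lift_action N n x i a * h a)
       = h (n i + 1) + (\<Sum>a=1..n i. x i a * (h a - h (n i + 1)))"
proof -
  have "(\<Sum>a=1..n i + 1. lift_action N n x i a * h a)
      = (\<Sum>a=1..n i. x i a * h a) + (1 - (\<Sum>a=1..n i. x i a)) * h (n i + 1)"
    using assms by (simp add: lift_action_def)
  also have "\<dots> = h (n i + 1) + (\<Sum>a=1..n i. x i a * (h a - h (n i + 1)))"
    by (simp add: algebra_simps sum_subtractf sum_distrib_left)
  finally show ?thesis .
qed

text \<open>
  There is no interaction of player \<open>i\<close> with itself, so the utility is affine in the own action;
  the marginals are the slopes. The constant \<open>B\<close> collects what is left when the own transformed
  action is zero.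
\<close>

lemma utility_affine_own:
  assumes i: "i \<in> {1..N}"
  shows "\<exists>B. \<forall>v. utility N n Q r i (lift_action N n (x(i := v)))
                = B + (\<Sum>a=1..n i. v a * marginal N n Q r i a x)"
proof -
  define h where "h = (\<lambda>a. r i a + (\<Sum>k\<in>{1..N} - {i}. \<Sum>b=1..n k + 1. Q i k a b * lift_action N n x k b))"
  define B0 where "B0 = (\<Sum>j\<in>{1..N} - {i}. \<Sum>a=1..n j + 1. r j a * lift_action N n x j a)"
  have hm: "h a - h (n i + 1) = marginal N n Q r i a x" for a
    by (simp add: h_def marginal_def sum_subtractf left_diff_distrib)
  have "utility N n Q r i (lift_action N n (x(i := v)))
      = B0 + h (n i + 1) + (\<Sum>a=1..n i. v a * marginal N n Q r i a x)" for v
  proof -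
    let ?L = "lift_action N n (x(i := v))"
    have "(\<Sum>k\<in>{1..N} - {i}. \<Sum>a=1..n i + 1. \<Sum>b=1..n k + 1. ?L i a * Q i k a b * ?L k b)
        = (\<Sum>k\<in>{1..N} - {i}. \<Sum>a=1..n i + 1. \<Sum>b=1..n k + 1. ?L i a * Q i k a b * lift_action N n x k b)"
      by (intro sum.cong refl) (simp add: lift_action_update_other)
    also have "\<dots> = (\<Sum>a=1..n i + 1. \<Sum>k\<in>{1..N} - {i}. \<Sum>b=1..n k + 1. ?L i a * Q i k a b * lift_action N n x k b)"
      by (rule sum.swap)
    also have "\<dots> = (\<Sum>a=1..n i + 1. ?L i a * (\<Sum>k\<in>{1..N} - {i}. \<Sum>b=1..n k + 1. Q i k a b * lift_action N n x k b))"
      by (simp only: sum_distrib_left mult.assoc)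
    finally have 1: "(\<Sum>k\<in>{1..N} - {i}. \<Sum>a=1..n i + 1. \<Sum>b=1..n k + 1. ?L i a * Q i k a b * ?L k b) = \<dots>" .
    have "(\<Sum>j=1..N. \<Sum>a=1..n j + 1. r j a * ?L j a)
        = (\<Sum>a=1..n i + 1. r i a * ?L i a) + (\<Sum>j\<in>{1..N} - {i}. \<Sum>a=1..n j + 1. r j a * ?L j a)"
      using i by (intro sum.remove) auto
    also have "(\<Sum>j\<in>{1..N} - {i}. \<Sum>a=1..n j + 1. r j a * ?L j a) = B0"
      unfolding B0_def by (intro sum.cong refl) (simp add: lift_action_update_other)
    finally have 2: "(\<Sum>j=1..N. \<Sum>a=1..n j + 1. r j a * ?L j a)
        = (\<Sum>a=1..n i + 1. r i a * ?L i a) + B0" .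
    have "utility N n Q r i ?L = (\<Sum>a=1..n i + 1. ?L i a * h a) + B0"
      unfolding utility_def 1 2 h_def distrib_left sum.distrib by (simp only: mult.commute[of "r i _"] add_ac)
    also have "\<dots> = B0 + h (n i + 1) + (\<Sum>a=1..n i. v a * marginal N n Q r i a x)"
      unfolding sum_lift_action[OF i] hm by simp
    finally show ?thesis .
  qed
  then show ?thesis by blast
qed

lemma reg_utility_own:
  assumes i: "i \<in> {1..N}"
  shows "\<exists>B. \<forall>v. reg_utility N n Q r \<tau> i (x(i := v))
      = B + (\<Sum>a=1..n i. v a * marginal N n Q r i a x)
        - \<tau> * (\<Sum>a=1..n i. v a * ln (v a))
        - \<tau> * ((1 - (\<Sum>a=1..n i. v a)) * ln (1 - (\<Sum>a=1..n i. v a)))"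
  using utility_affine_own[OF i, of n Q r x] by (auto simp: reg_utility_def)

section \<open>Best responses are logit distributions\<close>

text \<open>
  The tangent inequality \<open>ln u \<le> u - 1\<close> at \<open>u = p / t\<close>, strict unless \<open>u = 1\<close>.
\<close>

lemma gibbs_term:
  fixes p t :: real
  assumes "p > 0" "t \<ge> 0"
  shows "t * (ln p - ln t) \<le> p - t"
    and "t * (ln p - ln t) = p - t \<Longrightarrow> t = p"
proof -
  have "t * (ln p - ln t) < p - t" if "t \<noteq> p"
  proof (cases "t = 0")
    case False
    then have t: "t > 0" using assms by simp
    have "ln (p / t) < p / t - 1"
      using ln_eq_minus_one[of "p / t"] ln_le_minus_one[of "p / t"] t assms(1) that
      by (smt (verit, best) divide_pos_pos divide_eq_1_iff)
    then have "t * ln (p / t) < t * (p / t - 1)"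
      using t by (rule mult_strict_left_mono)
    then show ?thesis using t assms(1) by (simp add: ln_div algebra_simps)
  qed (use assms in auto)
  then show "t * (ln p - ln t) \<le> p - t" "t * (ln p - ln t) = p - t \<Longrightarrow> t = p"
    by fastforce+
qed

text \<open>
  Gibbs' inequality. If the slopes \<open>c\<close> are \<open>\<tau>\<close> times the log-odds of \<open>p\<close> against the
  eliminated weight \<open>P\<close>, then the objective at \<open>v\<close> falls short of its value at \<open>p\<close> by
  \<open>\<tau>\<close> times the relative entropy of \<open>v\<close> with respect to \<open>p\<close>. Boundary points \<open>v\<close> are
  included, which excludes them as maximizers.
\<close>

lemma gibbs_maximum:
  fixes p v c :: "nat \<Rightarrow> real" and m :: nat
  defines "P \<equiv> 1 - (\<Sum>a=1..m. p a)" and "V \<equiv> 1 - (\<Sum>a=1..m. v a)"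
  assumes "\<tau> > 0" and p: "\<And>a. a \<in> {1..m} \<Longrightarrow> p a > 0" and P: "P > 0"
    and v: "\<And>a. a \<in> {1..m} \<Longrightarrow> v a \<ge> 0" and V: "V \<ge> 0"
    and c: "\<And>a. a \<in> {1..m} \<Longrightarrow> c a = \<tau> * (ln (p a) - ln P)"
  defines "F \<equiv> \<lambda>w W. (\<Sum>a=1..m. w a * c a) - \<tau> * (\<Sum>a=1..m. w a * ln (w a)) - \<tau> * (W * ln W)"
  shows "F v V \<le> F p P"
    and "F v V = F p P \<Longrightarrow> a \<in> {1..m} \<Longrightarrow> v a = p a"
proof -
  have val: "F w (1 - (\<Sum>a=1..m. w a)) = - \<tau> * ln P
      + \<tau> * ((\<Sum>a=1..m. w a * (ln (p a) - ln (w a)))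
             + (1 - (\<Sum>a=1..m. w a)) * (ln P - ln (1 - (\<Sum>a=1..m. w a))))" for w
  proof -
    have "(\<Sum>a=1..m. w a * c a) = \<tau> * (\<Sum>a=1..m. w a * ln (p a)) - \<tau> * ln P * (\<Sum>a=1..m. w a)"
      by (simp add: c sum_distrib_left sum_subtractf[symmetric] algebra_simps)
    then show ?thesis
      unfolding F_def by (simp add: algebra_simps sum_subtractf)
  qed
  \<comment> \<open>\<open>d\<close> and \<open>D\<close> are the nonnegative defects of
    \<open>gibbs_term\<close>; they sum to the relative entropy because the total weights of
    \<open>p\<close> and \<open>v\<close> are both 1.\<close>
  define d where "d = (\<lambda>a. p a - v a - v a * (ln (p a) - ln (v a)))"
  define D where "D = P - V - V * (ln P - ln V)"
  have d: "d a \<ge> 0" if "a \<in> {1..m}" for a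
    using gibbs_term(1)[OF p v] that by (simp add: d_def)
  have D: "D \<ge> 0"
    using gibbs_term(1)[OF P V] by (simp add: D_def)
  have total: "(\<Sum>a=1..m. d a) + D = - ((\<Sum>a=1..m. v a * (ln (p a) - ln (v a))) + V * (ln P - ln V))"
  proof -
    have "(\<Sum>a=1..m. d a)
        = (\<Sum>a=1..m. p a) - (\<Sum>a=1..m. v a) - (\<Sum>a=1..m. v a * (ln (p a) - ln (v a)))"
      by (simp add: d_def sum_subtractf)
    then show ?thesis by (simp add: D_def P_def V_def)
  qed
  have Fp: "F p P = - \<tau> * ln P"
    using val[of p] by (simp add: P_def)
  have Fv: "F v V = - \<tau> * ln P
      + \<tau> * ((\<Sum>a=1..m. v a * (ln (p a) - ln (v a))) + V * (ln P - ln V))"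
    unfolding V_def by (rule val)
  have gap: "F p P - F v V = \<tau> * ((\<Sum>a=1..m. d a) + D)"
    unfolding total Fp Fv by (simp add: right_diff_distrib distrib_left)
  have s: "(\<Sum>a=1..m. d a) \<ge> 0" using d by (intro sum_nonneg) auto
  show "F v V \<le> F p P"
    using gap s D \<open>\<tau> > 0\<close> by (smt (verit) mult_nonneg_nonneg)
  assume "F v V = F p P" "a \<in> {1..m}"
  then have "(\<Sum>a=1..m. d a) = 0"
    using gap s D \<open>\<tau> > 0\<close> by (smt (verit) mult_eq_0_iff)
  then have "d a = 0"
    using d \<open>a \<in> {1..m}\<close> by (subst (asm) sum_nonneg_eq_0_iff) auto
  then show "v a = p a"
    using gibbs_term(2)[OF p v] \<open>a \<in> {1..m}\<close> by (simp add: d_def)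
qed

text \<open>
  The logit (softmax) distribution in which the eliminated coordinate has marginal 0 and therefore
  contributes the summand 1 to the denominator.
\<close>

definition logit_action ::
    "nat \<Rightarrow> (nat \<Rightarrow> nat) \<Rightarrow> (nat \<Rightarrow> nat \<Rightarrow> nat \<Rightarrow> nat \<Rightarrow> real) \<Rightarrow> (nat \<Rightarrow> nat \<Rightarrow> real)
      \<Rightarrow> real \<Rightarrow> nat \<Rightarrow> joint_action \<Rightarrow> nat \<Rightarrow> real" where
  "logit_action N n Q r \<tau> i x =
     (\<lambda>j\<in>{1..n i}. exp (marginal N n Q r i j x / \<tau>)
                    / (1 + (\<Sum>a=1..n i. exp (marginal N n Q r i a x / \<tau>))))"

lemma logit_denominator_pos: "1 + (\<Sum>a=1..m. exp (f a)) > (0::real)"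
  by (intro add_pos_nonneg sum_nonneg) auto

lemma logit_action_slack:
  "1 - (\<Sum>j=1..n i. logit_action N n Q r \<tau> i x j)
    = 1 / (1 + (\<Sum>a=1..n i. exp (marginal N n Q r i a x / \<tau>)))"
proof -
  define S where "S = (\<Sum>a=1..n i. exp (marginal N n Q r i a x / \<tau>))"
  have "1 + S > 0"
    unfolding S_def by (rule logit_denominator_pos)
  moreover have "(\<Sum>j=1..n i. logit_action N n Q r \<tau> i x j) = S / (1 + S)"
    by (simp add: logit_action_def S_def sum_divide_distrib)
  ultimately have "1 - (\<Sum>j=1..n i. logit_action N n Q r \<tau> i x j) = 1 / (1 + S)"
    by (simp add: field_simps)
  then show ?thesis by (simp add: S_def)
qed

lemma logit_action_pos: "j \<in> {1..n i} \<Longrightarrow> logit_action N n Q r \<tau> i x j > 0"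
  using logit_denominator_pos[of "\<lambda>a. marginal N n Q r i a x / \<tau>" "n i"]
  by (simp add: logit_action_def)

lemma logit_action_slack_pos: "1 - (\<Sum>j=1..n i. logit_action N n Q r \<tau> i x j) > 0"
  unfolding logit_action_slack by (intro divide_pos_pos logit_denominator_pos) simp

lemma logit_action_log_odds:
  assumes "\<tau> > 0" "j \<in> {1..n i}"
  shows "marginal N n Q r i j x
       = \<tau> * (ln (logit_action N n Q r \<tau> i x j) - ln (1 - (\<Sum>j=1..n i. logit_action N n Q r \<tau> i x j)))"
  unfolding logit_action_slack
  using assms logit_denominator_pos[of "\<lambda>a. marginal N n Q r i a x / \<tau>" "n i"]
  by (simp add: logit_action_def ln_div)

lemma logit_action_transformed: "logit_action N n Q r \<tau> i x \<in> transformed_actions n i"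
  using logit_action_pos[of _ n i N Q r \<tau> x] logit_action_slack_pos[of N n Q r \<tau> i x]
  by (auto simp: transformed_actions_def less_imp_le) (simp add: logit_action_def)

lemma best_response_iff_logit:
  assumes "\<tau> > 0" and i: "i \<in> {1..N}" and x: "x i \<in> transformed_actions n i"
  shows "(\<forall>y\<in>transformed_actions n i. reg_utility N n Q r \<tau> i x \<ge> reg_utility N n Q r \<tau> i (x(i := y)))
     \<longleftrightarrow> x i = logit_action N n Q r \<tau> i x" (is "?L \<longleftrightarrow> ?R")
proof -
  let ?p = "logit_action N n Q r \<tau> i x"
  obtain B where B: "\<And>v. reg_utility N n Q r \<tau> i (x(i := v))
      = B + ((\<Sum>a=1..n i. v a * marginal N n Q r i a x)
        - \<tau> * (\<Sum>a=1..n i. v a * ln (v a))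
        - \<tau> * ((1 - (\<Sum>a=1..n i. v a)) * ln (1 - (\<Sum>a=1..n i. v a))))"
    using reg_utility_own[OF i, of n Q r \<tau> x] by (auto simp: algebra_simps)
  have le: "reg_utility N n Q r \<tau> i (x(i := v)) \<le> reg_utility N n Q r \<tau> i (x(i := ?p))"
    and eq: "reg_utility N n Q r \<tau> i (x(i := v)) = reg_utility N n Q r \<tau> i (x(i := ?p)) \<Longrightarrow>
      a \<in> {1..n i} \<Longrightarrow> v a = ?p a" if v: "v \<in> transformed_actions n i" for v a
  proof -
    have v0: "\<And>a. a \<in> {1..n i} \<Longrightarrow> 0 \<le> v a" and V0: "0 \<le> 1 - (\<Sum>a=1..n i. v a)"
      using v by (auto simp: transformed_actions_def)
    note gibbs = gibbs_maximum[where m = "n i" and p = ?p and v = v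
        and c = "\<lambda>a. marginal N n Q r i a x" and \<tau> = \<tau>,
        OF assms(1) logit_action_pos logit_action_slack_pos v0 V0 logit_action_log_odds[OF assms(1)]]
    show "reg_utility N n Q r \<tau> i (x(i := v)) \<le> reg_utility N n Q r \<tau> i (x(i := ?p))"
      unfolding B by (rule add_left_mono) (rule gibbs(1))
    assume "reg_utility N n Q r \<tau> i (x(i := v)) = reg_utility N n Q r \<tau> i (x(i := ?p))"
      and a: "a \<in> {1..n i}"
    then show "v a = ?p a"
      unfolding B add_left_cancel by (intro gibbs(2))
  qed
  show ?thesis
  proof
    assume ?L
    then have "reg_utility N n Q r \<tau> i (x(i := x i)) = reg_utility N n Q r \<tau> i (x(i := ?p))"
      using le[OF x] logit_action_transformed[of N n Q r \<tau> i x] by (simp add: antisym)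
    then have "\<And>a. a \<in> {1..n i} \<Longrightarrow> x i a = ?p a" by (rule eq[OF x])
    then show ?R
      using x logit_action_transformed[of N n Q r \<tau> i x]
      by (intro extensionalityI[of _ "{1..n i}"]) (auto simp: transformed_actions_def)
  next
    assume ?R
    then have "x(i := ?p) = x" by (metis fun_upd_triv)
    then show ?L using le by metis
  qed
qed

text \<open>
  A vanishing score prescribes the odds \<open>x\<^sub>i\<^sup>j / s\<^sub>i\<close>; since the weights sum to 1, the odds
  determine the action.
\<close>

lemma logit_iff_score_zero:
  assumes "\<tau> > 0" and ext: "x i \<in> extensional {1..n i}"
  shows "x i = logit_action N n Q r \<tau> i x
     \<longleftrightarrow> interior_at n i x \<and> (\<forall>j\<in>{1..n i}. score N n Q r \<tau> i j x = 0)" (is "?L \<longleftrightarrow> ?R")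
proof
  assume L: ?L
  have s: "slack n i x = 1 - (\<Sum>j=1..n i. logit_action N n Q r \<tau> i x j)"
    unfolding slack_def by (subst L) simp
  show ?R
    unfolding interior_at_def score_def s
    using logit_action_pos[of _ n i N Q r \<tau> x] logit_action_slack_pos[of N n Q r \<tau> i x]
      logit_action_log_odds[of \<tau> _ n i N Q r x] assms L
    by (auto simp: right_diff_distrib)
next
  assume R: ?R
  let ?s = "slack n i x"
  have s: "?s > 0" and pos: "\<And>j. j \<in> {1..n i} \<Longrightarrow> x i j > 0"
    using R by (auto simp: interior_at_def)
  have e: "exp (marginal N n Q r i j x / \<tau>) = x i j / ?s" if "j \<in> {1..n i}" for j
  proof -
    have "marginal N n Q r i j x / \<tau> = ln (x i j) - ln ?s"
      using R that \<open>\<tau> > 0\<close> by (auto simp: score_def field_simps)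
    then show ?thesis using s pos[OF that] by (simp add: exp_diff)
  qed
  have "(\<Sum>a=1..n i. exp (marginal N n Q r i a x / \<tau>)) = (\<Sum>a=1..n i. x i a) / ?s"
    by (simp add: e sum_divide_distrib)
  then have "1 + (\<Sum>a=1..n i. exp (marginal N n Q r i a x / \<tau>)) = 1 / ?s"
    using s by (simp add: slack_def field_simps)
  then have "x i j = logit_action N n Q r \<tau> i x j" if "j \<in> {1..n i}" for j
    using that s by (simp add: logit_action_def e)
  then show ?L
    using ext by (intro extensionalityI[of _ "{1..n i}"]) (auto simp: logit_action_def)
qed

section \<open>Existence of equilibria\<close>

lemma nash_equilibria_eq_logit_fixed_points:
  assumes "\<tau> > 0"
  shows "nash_equilibria N (transformed_actions n) (reg_utility N n Q r \<tau>)
       = {x \<in> PiE {1..N} (transformed_actions n). \<forall>i\<in>{1..N}. x i = logit_action N n Q r \<tau> i x}"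
  unfolding nash_equilibria_def
  by (intro Collect_cong conj_cong refl ball_cong best_response_iff_logit[OF assms]) (auto dest: PiE_mem)

text \<open>
  The logit map is defined on the whole unit cube of dimension \<open>\<Sum>\<^sub>i n i\<close> and has values in it, so
  Brouwer's theorem for cubes applies; positivity of the eliminated weights puts the fixed points
  into the product of simplices.
\<close>

lemma exists_logit_fixed_point:
  assumes "\<tau> > 0"
  shows "\<exists>x\<in>PiE {1..N} (transformed_actions n). \<forall>i\<in>{1..N}. x i = logit_action N n Q r \<tau> i x"
proof -
  define I where "I = Sigma {1..N} (\<lambda>i. {1..n i})"
  \<comment> \<open>\<open>U\<close> regroups a point of the cube into a joint action.\<close>
  define U where "U = (\<lambda>z :: nat \<times> nat \<Rightarrow> real. \<lambda>i\<in>{1..N}. \<lambda>j\<in>{1..n i}. z (i, j))"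
  define f where "f = (\<lambda>z (i, j). logit_action N n Q r \<tau> i (U z) j)"
  have contU: "continuous_on A (\<lambda>z. U z k b)" for A k b
  proof (cases "k \<in> {1..N} \<and> b \<in> {1..n k}")
    case True
    have "(\<lambda>z. U z k b) = (\<lambda>z. z (k, b))" using True by (simp add: U_def)
    moreover have "continuous_on A (\<lambda>z :: nat \<times> nat \<Rightarrow> real. z (k, b))"
      by (rule continuous_on_subset[OF continuous_on_product_coordinates]) simp
    ultimately show ?thesis by (simp only:)
  next
    case False
    then have "(\<lambda>z. U z k b) = (\<lambda>z. U (\<lambda>_. 0) k b)" by (auto simp: U_def restrict_def)
    then show ?thesis by (metis continuous_on_const)
  qed
  have contL: "continuous_on A (\<lambda>z. lift_action N n (U z) k b)" for A k b
    by (cases "k \<in> {1..N}"; cases "b = n k + 1")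
       (auto simp: lift_action_def intro!: continuous_intros contU)
  have contm: "continuous_on A (\<lambda>z. marginal N n Q r i j (U z))" for A i j
    unfolding marginal_def by (intro continuous_intros contL)
  have "\<exists>z\<in>PiE I (\<lambda>_. {0..1}). \<forall>p\<in>I. f z p = z p"
  proof (rule brouwer_unit_cube)
    show "finite I" by (simp add: I_def)
    fix p assume "p \<in> I"
    then obtain i j where p: "p = (i, j)" "j \<in> {1..n i}"
      by (auto simp: I_def)
    have "1 + (\<Sum>a=1..n i. exp (marginal N n Q r i a y / \<tau>)) \<noteq> 0" for y
      using logit_denominator_pos[of "\<lambda>a. marginal N n Q r i a y / \<tau>" "n i"] by simp
    then show "continuous_on (PiE I (\<lambda>_. {0..1})) (\<lambda>z. f z p)"
      using p assms
      by (auto simp: f_def logit_action_def intro!: continuous_intros contm)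
    fix z
    have "0 \<le> logit_action N n Q r \<tau> i (U z) a" if "a \<in> {1..n i}" for a
      using logit_action_pos[where n = n and i = i, OF that] by (rule less_imp_le)
    then have "logit_action N n Q r \<tau> i (U z) j \<le> (\<Sum>a=1..n i. logit_action N n Q r \<tau> i (U z) a)"
      using p(2) by (intro member_le_sum) auto
    then show "f z p \<in> {0..1}"
      using p logit_action_pos[where n = n and i = i, OF p(2), of N Q r \<tau> "U z"] logit_action_slack_pos[of N n Q r \<tau> i "U z"]
      by (simp add: f_def)
  qed
  then obtain z where "\<forall>p\<in>I. f z p = z p" by blast
  then have z: "\<And>i j. i \<in> {1..N} \<Longrightarrow> j \<in> {1..n i} \<Longrightarrow> logit_action N n Q r \<tau> i (U z) j = z (i, j)"
    by (auto simp: I_def f_def)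
  have fixed: "U z i = logit_action N n Q r \<tau> i (U z)" if i: "i \<in> {1..N}" for i
    by (rule extensionalityI[of _ "{1..n i}"])
       (use i z[OF i] in \<open>auto simp: logit_action_def U_def\<close>)
  show ?thesis
  proof (rule bexI[of _ "U z"])
    show "\<forall>i\<in>{1..N}. U z i = logit_action N n Q r \<tau> i (U z)" using fixed by blast
    show "U z \<in> PiE {1..N} (transformed_actions n)"
    proof (rule PiE_I)
      fix i assume "i \<in> {1..N}"
      then show "U z i \<in> transformed_actions n i"
        by (subst fixed) (auto intro: logit_action_transformed)
    qed (auto simp: U_def)
  qed
qed

section \<open>Partial derivatives of the losses\<close>

lemma sum_fun_upd:
  fixes g :: "'a \<Rightarrow> 'b \<Rightarrow> 'c::comm_monoid_add"
  assumes "finite A" "j \<in> A"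
  shows "(\<Sum>a\<in>A. g a ((v(j := t)) a)) = g j t + (\<Sum>a\<in>A - {j}. g a (v a))"
proof -
  have "(\<Sum>a\<in>A. g a ((v(j := t)) a)) = g j t + (\<Sum>a\<in>A - {j}. g a ((v(j := t)) a))"
    using assms by (subst sum.remove[of A j]) auto
  also have "(\<Sum>a\<in>A - {j}. g a ((v(j := t)) a)) = (\<Sum>a\<in>A - {j}. g a (v a))"
    by (intro sum.cong) auto
  finally show ?thesis .
qed

lemma slack_update:
  assumes "j \<in> {1..n i}"
  shows "slack n i (x(i := (x i)(j := t))) = slack n i x + x i j - t"
proof -
  have "(\<Sum>a=1..n i. ((x i)(j := t)) a) = t + (\<Sum>a\<in>{1..n i} - {j}. x i a)"
    using sum_fun_upd[of "{1..n i}" j "\<lambda>_ u. u"] assms by simp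
  moreover have "(\<Sum>a=1..n i. x i a) = x i j + (\<Sum>a\<in>{1..n i} - {j}. x i a)"
    using assms by (intro sum.remove) auto
  ultimately show ?thesis by (simp add: slack_def)
qed

lemma partial_deriv_reg_utility:
  assumes i: "i \<in> {1..N}" and j: "j \<in> {1..n i}" and x: "interior_at n i x"
  shows "partial_deriv i j (reg_utility N n Q r \<tau> i) x = score N n Q r \<tau> i j x"
proof -
  obtain B where B: "\<And>v. reg_utility N n Q r \<tau> i (x(i := v))
      = B + (\<Sum>a=1..n i. v a * marginal N n Q r i a x)
        - \<tau> * (\<Sum>a=1..n i. v a * ln (v a))
        - \<tau> * ((1 - (\<Sum>a=1..n i. v a)) * ln (1 - (\<Sum>a=1..n i. v a)))"
    using reg_utility_own[OF i] by blast
  define K where "K = (\<Sum>a\<in>{1..n i} - {j}. x i a * marginal N n Q r i a x)"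
  define L where "L = (\<Sum>a\<in>{1..n i} - {j}. x i a * ln (x i a))"
  define S where "S = slack n i x + x i j"
  have pos: "x i j > 0" "S - x i j > 0"
    using x j by (auto simp: interior_at_def S_def)
  have "(\<lambda>t. reg_utility N n Q r \<tau> i (x(i := (x i)(j := t))))
      = (\<lambda>t. B + (t * marginal N n Q r i j x + K) - \<tau> * (t * ln t + L) - \<tau> * ((S - t) * ln (S - t)))"
  proof
    fix t
    have 1: "(\<Sum>a=1..n i. ((x i)(j := t)) a * marginal N n Q r i a x) = t * marginal N n Q r i j x + K"
      using sum_fun_upd[of "{1..n i}" j "\<lambda>a u. u * marginal N n Q r i a x" "x i" t] j by (simp add: K_def)
    have 2: "(\<Sum>a=1..n i. ((x i)(j := t)) a * ln (((x i)(j := t)) a)) = t * ln t + L"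
      using sum_fun_upd[of "{1..n i}" j "\<lambda>a u. u * ln u" "x i" t] j by (simp add: L_def)
    have 3: "1 - (\<Sum>a=1..n i. ((x i)(j := t)) a) = S - t"
      using slack_update[where n = n and i = i, OF j, of x t] by (simp add: slack_def S_def)
    show "reg_utility N n Q r \<tau> i (x(i := (x i)(j := t)))
      = B + (t * marginal N n Q r i j x + K) - \<tau> * (t * ln t + L) - \<tau> * ((S - t) * ln (S - t))"
      unfolding B 1 2 3 ..
  qed
  moreover have "((\<lambda>t. B + (t * marginal N n Q r i j x + K) - \<tau> * (t * ln t + L) - \<tau> * ((S - t) * ln (S - t)))
      has_field_derivative score N n Q r \<tau> i j x) (at (x i j))"
    using pos by (auto intro!: derivative_eq_intros simp: score_def S_def field_simps)
  ultimately show ?thesis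
    unfolding partial_deriv_def by (simp add: DERIV_imp_deriv)
qed

text \<open>
  The loss is the squared score at interior points, so computing its derivatives through the score
  requires that small changes of one coordinate stay in the interior.
\<close>

lemma interior_at_update_eventually:
  assumes x: "interior_at n i x" and m: "m \<in> {1..n k}"
  shows "\<forall>\<^sub>F t in nhds (x k m). interior_at n i (x(k := (x k)(m := t)))"
proof (cases "k = i")
  case True
  have "x i m \<in> {0<..<slack n i x + x i m}"
    using x m True by (auto simp: interior_at_def)
  then have "\<forall>\<^sub>F t in nhds (x i m). t \<in> {0<..<slack n i x + x i m}"
    by (intro eventually_nhds_in_open) auto
  then show ?thesis
    unfolding True
  proof eventually_elim
    case (elim t)
    then show ?case
      using x m True slack_update[of m n i x t] by (auto simp: interior_at_def)
  qed
next
  case False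
  then show ?thesis using x by (simp add: interior_at_def slack_def)
qed

lemma partial_deriv_loss:
  assumes i: "i \<in> {1..N}" and j: "j \<in> {1..n i}" and m: "m \<in> {1..n k}" and x: "interior_at n i x"
    and D: "((\<lambda>t. score N n Q r \<tau> i j (x(k := (x k)(m := t)))) has_field_derivative D) (at (x k m))"
  shows "partial_deriv k m (loss N n Q r \<tau> i j) x = 2 * score N n Q r \<tau> i j x * D"
proof -
  have "\<forall>\<^sub>F t in nhds (x k m). loss N n Q r \<tau> i j (x(k := (x k)(m := t)))
      = (score N n Q r \<tau> i j (x(k := (x k)(m := t))))\<^sup>2"
    using interior_at_update_eventually[OF x m]
    by eventually_elim (simp add: loss_def partial_deriv_reg_utility[where n = n and i = i, OF i j])
  moreover have "((\<lambda>t. (score N n Q r \<tau> i j (x(k := (x k)(m := t))))\<^sup>2)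
      has_field_derivative 2 * score N n Q r \<tau> i j x * D) (at (x k m))"
    using DERIV_power[OF D, of 2] by (simp add: mult_ac)
  ultimately have "((\<lambda>t. loss N n Q r \<tau> i j (x(k := (x k)(m := t))))
      has_field_derivative 2 * score N n Q r \<tau> i j x * D) (at (x k m))"
    by (subst DERIV_cong_ev[OF refl _ refl])
  then show ?thesis
    unfolding partial_deriv_def by (rule DERIV_imp_deriv)
qed

lemma score_has_own_derivative:
  assumes j: "j \<in> {1..n i}" and m: "m \<in> {1..n i}" and x: "interior_at n i x"
  shows "((\<lambda>t. score N n Q r \<tau> i j (x(i := (x i)(m := t)))) has_field_derivative
            - \<tau> * ((if m = j then 1 / x i j else 0) + 1 / slack n i x)) (at (x i m))"
proof -
  have pos: "x i j > 0" "slack n i x > 0" using x j by (auto simp: interior_at_def)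
  show ?thesis
    unfolding score_def marginal_update_own slack_update[where n = n and i = i, OF m]
    using pos by (cases "m = j") (auto intro!: derivative_eq_intros simp: algebra_simps)
qed

text \<open>
  Mere existence of the derivative suffices: it enters the gradient of the loss multiplied by the
  score, which is zero at the points of interest.
\<close>

lemma score_differentiable_other:
  assumes "k \<noteq> i"
  shows "\<exists>D. ((\<lambda>t. score N n Q r \<tau> i j (x(k := (x k)(m := t)))) has_field_derivative D) (at (x k m))"
proof -
  have upd: "(\<lambda>t. ((x k)(m := t)) a) differentiable (at t0)" for a t0
    by (cases "a = m") auto
  have lift: "(\<lambda>t. lift_action N n (x(k := (x k)(m := t))) l b) differentiable (at t0)" for l b t0
  proof (cases "l = k \<and> k \<in> {1..N}")
    case True
    show ?thesis
    proof (cases "b = n k + 1")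
      case b: True
      have "(\<lambda>t. lift_action N n (x(k := (x k)(m := t))) l b) = (\<lambda>t. 1 - (\<Sum>a=1..n k. ((x k)(m := t)) a))"
        using True b by (auto simp: lift_action_def)
      then show ?thesis using upd by (auto intro!: derivative_intros)
    next
      case False
      then have "(\<lambda>t. lift_action N n (x(k := (x k)(m := t))) l b) = (\<lambda>t. ((x k)(m := t)) b)"
        using True by (auto simp: lift_action_def)
      then show ?thesis using upd by simp
    qed
  next
    case False
    then have "(\<lambda>t. lift_action N n (x(k := (x k)(m := t))) l b) = (\<lambda>t. lift_action N n x l b)"
      by (auto simp: lift_action_def)
    then show ?thesis by simp
  qed
  have "(\<lambda>t. marginal N n Q r i j (x(k := (x k)(m := t)))) differentiable (at (x k m))"
    unfolding marginal_def using lift by (auto intro!: derivative_intros)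
  then have "(\<lambda>t. score N n Q r \<tau> i j (x(k := (x k)(m := t)))) differentiable (at (x k m))"
    using assms unfolding score_def slack_def by (auto intro!: derivative_intros)
  then show ?thesis
    by (simp add: real_differentiable_def)
qed

lemma partial_deriv_loss_zero:
  assumes i: "i \<in> {1..N}" and j: "j \<in> {1..n i}" and m: "m \<in> {1..n k}" and x: "interior_at n i x"
    and "score N n Q r \<tau> i j x = 0"
  shows "partial_deriv k m (loss N n Q r \<tau> i j) x = 0"
proof -
  obtain D where "((\<lambda>t. score N n Q r \<tau> i j (x(k := (x k)(m := t)))) has_field_derivative D) (at (x k m))"
    using score_has_own_derivative[OF j _ x] score_differentiable_other[of k i] m by metis
  from partial_deriv_loss[OF i j m x this] show ?thesis using assms by simp
qed

section \<open>Common stationary points have vanishing scores\<close>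

text \<open>
  The two bounds in the definition of the restricted actions, the second one with
  \<open>\<tau> powr (3 / 2)\<close> written as \<open>\<tau> * sqrt \<tau>\<close>.
\<close>

definition entry_floor :: "nat \<Rightarrow> (nat \<Rightarrow> nat) \<Rightarrow> real \<Rightarrow> real" where
  "entry_floor N n \<tau> = exp (- 1 / \<tau>\<^sup>2) / real (MAX k\<in>{1..N}. n k + 1)"

definition slack_floor :: "nat \<Rightarrow> (nat \<Rightarrow> nat) \<Rightarrow> real \<Rightarrow> real" where
  "slack_floor N n \<tau> = exp (- 1 / (\<tau> * sqrt \<tau>)) / real (MAX k\<in>{1..N}. n k + 1)"

lemma restricted_actions_iff:
  assumes "\<tau> > 0"
  shows "v \<in> restricted_actions N n \<tau> i \<longleftrightarrow>
     v \<in> extensional {1..n i} \<and> (\<forall>j\<in>{1..n i}. entry_floor N n \<tau> \<le> v j) \<and>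
     (\<Sum>j=1..n i. v j) \<le> 1 - slack_floor N n \<tau>"
proof -
  have "\<tau> powr (3 / 2) = \<tau> powr (1 + 1 / 2)" by simp
  also have "\<dots> = \<tau> * sqrt \<tau>"
    using assms by (simp only: powr_add powr_half_sqrt less_imp_le powr_one)
  finally show ?thesis
    by (auto simp: restricted_actions_def Let_def entry_floor_def slack_floor_def)
qed

lemma action_count_le_Max:
  fixes i N :: nat
  shows "i \<in> {1..N} \<Longrightarrow> n i + 1 \<le> (MAX k\<in>{1..N}. n k + 1)"
  by (intro Max_ge) auto

lemma floors_pos:
  assumes "i \<in> {1..N}"
  shows "entry_floor N n \<tau> > 0" "slack_floor N n \<tau> > 0"
  using action_count_le_Max[OF assms, of n] by (auto simp: entry_floor_def slack_floor_def)

lemma exp_minus_1_le_half: "exp (-1::real) \<le> 1 / 2"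
  using exp_ge_add_one_self[of "1::real"] by (simp add: exp_minus field_simps)

text \<open>
  Room for the two corners used in \<open>stationary_score_zero\<close>: with all but one of the weights at
  their floors, the remaining weight is at least one half.
\<close>

lemma floors_small:
  assumes "i \<in> {1..N}" "0 < \<tau>" "\<tau> \<le> 1"
  shows "real (n i) * entry_floor N n \<tau> + slack_floor N n \<tau> \<le> 1 / 2"
proof -
  define M where "M = real (MAX k\<in>{1..N}. n k + 1)"
  have M: "real (n i) + 1 \<le> M" "M > 0"
    using action_count_le_Max[OF assms(1), of n] unfolding M_def by linarith+
  have half: "exp (- 1 / y) \<le> 1 / 2" if "0 < y" "y \<le> 1" for y :: real
  proof -
    have "- 1 / y \<le> - 1" using that by (simp add: field_simps)
    then have "exp (- 1 / y) \<le> exp (- 1)" by simp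
    then show ?thesis using exp_minus_1_le_half by linarith
  qed
  have "\<tau>\<^sup>2 \<le> 1" "\<tau> * sqrt \<tau> \<le> 1"
    using assms by (auto simp: power_le_one mult_le_one)
  then have "exp (- 1 / \<tau>\<^sup>2) \<le> 1 / 2" "exp (- 1 / (\<tau> * sqrt \<tau>)) \<le> 1 / 2"
    using assms half[of "\<tau>\<^sup>2"] half[of "\<tau> * sqrt \<tau>"] by simp_all
  then have "real (n i) * entry_floor N n \<tau> \<le> real (n i) * (1 / 2 / M)"
    and "slack_floor N n \<tau> \<le> 1 / 2 / M"
    using M unfolding entry_floor_def slack_floor_def M_def[symmetric]
    by (intro mult_left_mono divide_right_mono; simp)+
  then have "real (n i) * entry_floor N n \<tau> + slack_floor N n \<tau> \<le> (real (n i) + 1) * (1 / 2 / M)"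
    unfolding distrib_right by linarith
  also have "\<dots> = (real (n i) + 1) / M * (1 / 2)" by simp
  also have "\<dots> \<le> 1 * (1 / 2)"
    using M by (intro mult_right_mono) auto
  finally show ?thesis by simp
qed

lemma restricted_action_interior:
  assumes "i \<in> {1..N}" "0 < \<tau>" "x i \<in> restricted_actions N n \<tau> i"
  shows "interior_at n i x" "x i \<in> transformed_actions n i"
  using assms(3) floors_pos[OF assms(1), of n \<tau>] unfolding restricted_actions_iff[OF assms(2)]
  by (force simp: interior_at_def slack_def transformed_actions_def)+

text \<open>
  Testing stationarity with a deviation of player \<open>i\<close> alone leaves only the derivatives in the own
  block, which are \<open>- 2 \<tau> g (1 / x\<^sub>i\<^sup>j + 1 / s\<^sub>i)\<close> in coordinate \<open>j\<close> and
  \<open>- 2 \<tau> g / s\<^sub>i\<close> in the others, with \<open>g\<close> the score.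
\<close>

lemma stationary_own_block:
  assumes i: "i \<in> {1..N}" and j: "j \<in> {1..n i}" and \<tau>: "\<tau> > 0"
    and x: "x \<in> stationary_points N n (PiE {1..N} (restricted_actions N n \<tau>)) (loss N n Q r \<tau> i j)"
    and v: "v \<in> restricted_actions N n \<tau> i"
  shows "score N n Q r \<tau> i j x *
     ((v j - x i j) / x i j + ((\<Sum>m=1..n i. v m) - (\<Sum>m=1..n i. x i m)) / slack n i x) \<le> 0"
proof -
  let ?X = "PiE {1..N} (restricted_actions N n \<tau>)" and ?g = "score N n Q r \<tau> i j x"
  let ?w = "\<lambda>m. (if m = j then 1 / x i j else 0) + 1 / slack n i x"
  have xX: "x \<in> ?X" using x by (simp add: stationary_points_def)
  then have int: "interior_at n i x"
    using i \<tau> by (intro restricted_action_interior(1)) auto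
  have "x(i := v) \<in> ?X"
    using xX v i by (auto simp: PiE_def extensional_def)
  then have "0 \<le> (\<Sum>k=1..N. \<Sum>m=1..n k.
      partial_deriv k m (loss N n Q r \<tau> i j) x * ((x(i := v)) k m - x k m))"
    using x unfolding stationary_points_def by blast
  also have "\<dots> = (\<Sum>m=1..n i. partial_deriv i m (loss N n Q r \<tau> i j) x * (v m - x i m))"
    using i by (subst sum.remove[of _ i]) (auto intro!: sum.neutral)
  also have "\<dots> = (\<Sum>m=1..n i. 2 * ?g * (- \<tau> * ?w m) * (v m - x i m))"
    by (intro sum.cong refl) (simp only: partial_deriv_loss[OF i j _ int score_has_own_derivative[OF j _ int]])
  also have "\<dots> = - 2 * \<tau> * (?g * (\<Sum>m=1..n i. ?w m * (v m - x i m)))"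
  proof -
    have "2 * ?g * (- \<tau> * w) * d = - 2 * \<tau> * (?g * (w * d))" for w d by simp
    then show ?thesis unfolding sum_distrib_left by (intro sum.cong refl)
  qed
  also have "(\<Sum>m=1..n i. ?w m * (v m - x i m))
      = (\<Sum>m=1..n i. (if m = j then (v j - x i j) / x i j else 0)) + (\<Sum>m=1..n i. (v m - x i m) / slack n i x)"
    unfolding sum.distrib[symmetric] by (intro sum.cong) (auto simp: distrib_right)
  also have "\<dots> = (v j - x i j) / x i j + ((\<Sum>m=1..n i. v m) - (\<Sum>m=1..n i. x i m)) / slack n i x"
    using j by (simp add: sum_divide_distrib[symmetric] sum_subtractf)
  finally show ?thesis
    using \<tau> by (simp add: mult_le_0_iff zero_le_mult_iff)
qed

lemma nonneg_quotients_zero: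
  fixes a b c d :: real
  assumes "a / c + b / d \<le> 0" "a \<ge> 0" "b \<ge> 0" "c > 0" "d > 0"
  shows "a = 0" "b = 0"
proof -
  have "a / c \<ge> 0" "b / d \<ge> 0" using assms by auto
  then have "a / c = 0" "b / d = 0" using assms(1) by linarith+
  then show "a = 0" "b = 0" using assms by auto
qed

text \<open>
  A single test deviation suffices for each sign of the score. It is the corner of the restricted
  actions that maximizes both bracketed terms of \<open>stationary_own_block\<close> times the score,
  so the inequality forces \<open>x\<^sub>i\<close> to agree with it in coordinate \<open>j\<close> and in total weight. At
  that corner the logarithm of the floor overrides the bounded remainder, with the wrong sign.
\<close>

lemma stationary_score_zero:
  assumes i: "i \<in> {1..N}" and j: "j \<in> {1..n i}" and \<tau>: "0 < \<tau>" "\<tau> \<le> 1"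
    and x: "x \<in> stationary_points N n (PiE {1..N} (restricted_actions N n \<tau>)) (loss N n Q r \<tau> i j)"
    and C: "\<bar>marginal N n Q r i j x\<bar> \<le> C" and small: "sqrt \<tau> * (C + 1) < 1"
  shows "score N n Q r \<tau> i j x = 0"
proof (rule ccontr)
  let ?g = "score N n Q r \<tau> i j x" and ?a = "entry_floor N n \<tau>" and ?b = "slack_floor N n \<tau>"
  define M where "M = real (MAX k\<in>{1..N}. n k + 1)"
  have M: "M \<ge> 1"
    using action_count_le_Max[OF i, of n] unfolding M_def by linarith
  assume g: "?g \<noteq> 0"
  have xi: "x i \<in> restricted_actions N n \<tau> i"
    using x i by (auto simp: stationary_points_def)
  then have xa: "\<And>m. m \<in> {1..n i} \<Longrightarrow> ?a \<le> x i m" and xb: "(\<Sum>m=1..n i. x i m) \<le> 1 - ?b"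
    using \<tau> by (auto simp: restricted_actions_iff)
  have pos: "?a > 0" "?b > 0" using floors_pos[OF i] by auto
  have xj: "x i j > 0" and s: "slack n i x > 0"
    using xa[OF j] xb pos by (auto simp: slack_def)
  have ab: "real (n i) * ?a + ?b \<le> 1 / 2" using floors_small[OF i \<tau>] .
  have lnhalf: "\<tau> * ln y \<ge> - 1" if "y \<ge> 1 / 2" for y :: real
  proof -
    have "ln y \<ge> - 1" using that exp_minus_1_le_half by (subst ln_ge_iff) auto
    then have "\<tau> * (- 1) \<le> \<tau> * ln y" using \<tau> by (intro mult_left_mono) auto
    then show ?thesis using \<tau> by simp
  qed
  have big: "C + 1 < 1 / sqrt \<tau>" using small \<tau> by (simp add: field_simps)
  have lnM: "\<tau> * ln M \<ge> 0" using M \<tau> by simp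
  consider "?g > 0" | "?g < 0" using g by linarith
  then show False
  proof cases
    case 1
    \<comment> \<open>The corner with as much weight as possible on \<open>j\<close>.\<close>
    define v where "v = (\<lambda>m\<in>{1..n i}. if m = j then 1 - ?b - (real (n i) - 1) * ?a else ?a)"
    have sumv: "(\<Sum>m=1..n i. v m) = 1 - ?b"
    proof -
      have "(\<Sum>m\<in>{1..n i} - {j}. v m) = (\<Sum>m\<in>{1..n i} - {j}. ?a)"
        by (intro sum.cong) (auto simp: v_def)
      also have "\<dots> = (real (n i) - 1) * ?a"
        using j by (simp add: of_nat_diff)
      finally show ?thesis
        using j by (subst sum.remove[of _ j]) (auto simp: v_def)
    qed
    have vj: "v j = 1 - ?b - (real (n i) - 1) * ?a" using j by (simp add: v_def)
    have vj': "v j \<ge> 1 / 2" "v j \<ge> ?a" using ab pos unfolding vj by (auto simp: algebra_simps)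
    have "v \<in> restricted_actions N n \<tau> i"
      using sumv vj'(2) j \<tau> vj by (auto simp: restricted_actions_iff v_def)
    from stationary_own_block[OF i j \<tau>(1) x this]
    have le: "(v j - x i j) / x i j + (1 - ?b - (\<Sum>m=1..n i. x i m)) / slack n i x \<le> 0"
      using 1 unfolding sumv by (simp add: mult_le_0_iff)
    have "(\<Sum>m\<in>{1..n i} - {j}. x i m) \<ge> of_nat (card ({1..n i} - {j})) * ?a"
      by (intro sum_bounded_below xa) auto
    then have "(\<Sum>m\<in>{1..n i} - {j}. x i m) \<ge> (real (n i) - 1) * ?a"
      using j by (simp add: of_nat_diff)
    moreover have "(\<Sum>m=1..n i. x i m) = x i j + (\<Sum>m\<in>{1..n i} - {j}. x i m)"
      using j by (intro sum.remove) auto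
    ultimately have "x i j \<le> v j" using xb vj by linarith
    then have "v j - x i j = 0" "1 - ?b - (\<Sum>m=1..n i. x i m) = 0"
      using nonneg_quotients_zero[OF le _ _ xj s] xb by auto
    then have sb: "slack n i x = ?b" and "x i j \<ge> 1 / 2"
      using vj' by (auto simp: slack_def)
    have "ln ?b = - 1 / (\<tau> * sqrt \<tau>) - ln M"
      using M unfolding slack_floor_def M_def[symmetric] by (simp add: ln_div)
    then have "\<tau> * ln ?b = - (1 / sqrt \<tau>) - \<tau> * ln M"
      using \<tau> by (simp add: right_diff_distrib)
    then have "?g < 0"
      using big lnM lnhalf[OF \<open>x i j \<ge> 1 / 2\<close>] C unfolding score_def sb by linarith
    then show False using 1 by simp
  next
    case 2
    \<comment> \<open>The corner with as little weight as possible on every coordinate.\<close>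
    define v where "v = (\<lambda>m\<in>{1..n i}. ?a)"
    have sumv: "(\<Sum>m=1..n i. v m) = real (n i) * ?a" by (simp add: v_def)
    have vj: "v j = ?a" using j by (simp add: v_def)
    have "v \<in> restricted_actions N n \<tau> i"
      using sumv ab \<tau> by (auto simp: restricted_actions_iff v_def)
    from stationary_own_block[OF i j \<tau>(1) x this]
    have "0 \<le> (?a - x i j) / x i j + (real (n i) * ?a - (\<Sum>m=1..n i. x i m)) / slack n i x"
      using 2 unfolding sumv vj by (simp add: mult_le_0_iff)
    then have le: "(x i j - ?a) / x i j + ((\<Sum>m=1..n i. x i m) - real (n i) * ?a) / slack n i x \<le> 0"
      by (simp add: diff_divide_distrib)
    have "(\<Sum>m=1..n i. x i m) \<ge> of_nat (card {1..n i}) * ?a"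
      by (intro sum_bounded_below xa) auto
    then have "x i j - ?a = 0" "(\<Sum>m=1..n i. x i m) - real (n i) * ?a = 0"
      using nonneg_quotients_zero[OF le _ _ xj s] xa[OF j] by auto
    then have xja: "x i j = ?a" and sh: "slack n i x \<ge> 1 / 2"
      using ab pos by (auto simp: slack_def)
    have "ln ?a = - 1 / \<tau>\<^sup>2 - ln M"
      using M unfolding entry_floor_def M_def[symmetric] by (simp add: ln_div)
    then have "\<tau> * ln ?a = - (1 / \<tau>) - \<tau> * ln M"
      using \<tau> by (simp add: right_diff_distrib power2_eq_square)
    moreover have "1 / sqrt \<tau> \<le> 1 / \<tau>"
    proof (rule divide_left_mono)
      show "\<tau> \<le> sqrt \<tau>" using \<tau> by (intro real_le_rsqrt) (simp add: power2_eq_square mult_left_le)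
    qed (use \<tau> in auto)
    ultimately have "?g > 0"
      using big lnM lnhalf[OF sh] C unfolding score_def xja by linarith
    then show False using 2 by simp
  qed
qed

section \<open>Logit distributions respect the floors\<close>

text \<open>
  The marginals are affine in the lifted actions of the opponents, whose entries lie in \<open>[0, 1]\<close>.
\<close>

lemma marginal_bounded:
  "\<exists>C\<ge>0. \<forall>x\<in>PiE {1..N} (transformed_actions n). \<forall>i\<in>{1..N}. \<forall>j\<in>{1..n i}.
     \<bar>marginal N n Q r i j x\<bar> \<le> C"
proof -
  define c where "c = (\<lambda>i j. \<bar>r i j - r i (n i + 1)\<bar>
     + (\<Sum>k\<in>{1..N} - {i}. \<Sum>b=1..n k + 1. \<bar>Q i k j b - Q i k (n i + 1) b\<bar>))"
  define C where "C = (\<Sum>i=1..N. \<Sum>j=1..n i. c i j)"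
  have c0: "c i j \<ge> 0" for i j
    unfolding c_def by (intro add_nonneg_nonneg sum_nonneg) auto
  have cC: "c i j \<le> C" if "i \<in> {1..N}" "j \<in> {1..n i}" for i j
  proof -
    have "c i j \<le> (\<Sum>j=1..n i. c i j)"
      using that c0 by (intro member_le_sum) auto
    also have "\<dots> \<le> C"
      unfolding C_def using that c0
      by (intro member_le_sum[of i "{1..N}" "\<lambda>i. \<Sum>j=1..n i. c i j"]) (auto intro: sum_nonneg)
    finally show ?thesis .
  qed
  have "\<bar>marginal N n Q r i j x\<bar> \<le> c i j" if x: "x \<in> PiE {1..N} (transformed_actions n)" for x i j
  proof -
    have lift: "\<bar>lift_action N n x k b\<bar> \<le> 1" if "k \<in> {1..N}" "b \<in> {1..n k + 1}" for k b
    proof -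
      have L: "lift_action N n x k \<in> simplex_actions n k"
        using lift_action_in_simplex[OF x] that(1) by (rule PiE_mem)
      then have "lift_action N n x k b \<le> (\<Sum>b=1..n k + 1. lift_action N n x k b)"
        using that(2) by (intro member_le_sum) (auto simp: simplex_actions_def)
      then show ?thesis using L that(2) by (auto simp: simplex_actions_def)
    qed
    have "\<bar>marginal N n Q r i j x\<bar> \<le> \<bar>r i j - r i (n i + 1)\<bar> + \<bar>\<Sum>k\<in>{1..N} - {i}. \<Sum>b=1..n k + 1.
        (Q i k j b - Q i k (n i + 1) b) * lift_action N n x k b\<bar>"
      unfolding marginal_def by (rule abs_triangle_ineq)
    also have "\<dots> \<le> c i j"
      unfolding c_def
    proof (intro add_left_mono order_trans[OF sum_abs] sum_mono)
      fix k b assume "k \<in> {1..N} - {i}" "b \<in> {1..n k + 1}"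
      then show "\<bar>(Q i k j b - Q i k (n i + 1) b) * lift_action N n x k b\<bar> \<le> \<bar>Q i k j b - Q i k (n i + 1) b\<bar>"
        using lift by (simp add: abs_mult mult_left_le)
    qed
    finally show ?thesis .
  qed
  moreover have "C \<ge> 0" unfolding C_def using c0 by (intro sum_nonneg) auto
  ultimately show ?thesis using cC by (meson order_trans)
qed

text \<open>
  The denominator is at most \<open>M exp (C / \<tau>)\<close>, so the eliminated weight is at least
  \<open>exp (- C / \<tau>) / M\<close> and the others are at least \<open>exp (- 2 C / \<tau>) / M\<close>. For small \<open>\<tau>\<close> the
  exponents \<open>C / \<tau>\<close> and \<open>2 C / \<tau>\<close> are dominated by \<open>1 / (\<tau> * sqrt \<tau>)\<close> and
  \<open>1 / \<tau>\<^sup>2\<close>.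
\<close>

lemma logit_action_restricted:
  assumes i: "i \<in> {1..N}" and \<tau>: "0 < \<tau>" "\<tau> \<le> 1" and "C \<ge> 0"
    and C: "\<And>j. j \<in> {1..n i} \<Longrightarrow> \<bar>marginal N n Q r i j x\<bar> \<le> C"
    and small: "sqrt \<tau> * (2 * C) \<le> 1"
  shows "logit_action N n Q r \<tau> i x \<in> restricted_actions N n \<tau> i"
proof -
  define M where "M = real (MAX k\<in>{1..N}. n k + 1)"
  define Z where "Z = 1 + (\<Sum>a=1..n i. exp (marginal N n Q r i a x / \<tau>))"
  have M: "real (n i) + 1 \<le> M"
    using action_count_le_Max[OF i, of n] unfolding M_def by linarith
  have Z0: "Z > 0" unfolding Z_def by (rule logit_denominator_pos)
  have "(\<Sum>a=1..n i. exp (marginal N n Q r i a x / \<tau>)) \<le> of_nat (card {1..n i}) * exp (C / \<tau>)"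
  proof (intro sum_bounded_above)
    fix a assume "a \<in> {1..n i}"
    then show "exp (marginal N n Q r i a x / \<tau>) \<le> exp (C / \<tau>)"
      using C[of a] \<tau> by (simp add: divide_right_mono abs_le_iff)
  qed
  then have "(\<Sum>a=1..n i. exp (marginal N n Q r i a x / \<tau>)) \<le> real (n i) * exp (C / \<tau>)"
    by simp
  moreover have "1 \<le> exp (C / \<tau>)" using \<tau> \<open>C \<ge> 0\<close> by simp
  ultimately have "Z \<le> (real (n i) + 1) * exp (C / \<tau>)"
    unfolding Z_def distrib_right by linarith
  also have "\<dots> \<le> M * exp (C / \<tau>)" using M by (intro mult_right_mono) auto
  finally have Z: "1 / (M * exp (C / \<tau>)) \<le> 1 / Z"
    using Z0 by (intro divide_left_mono) (auto intro: mult_pos_pos less_le_trans)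
  then have Z': "exp (- (C / \<tau>)) / M \<le> 1 / Z" by (simp add: exp_minus field_simps)
  have root: "\<tau> \<le> sqrt \<tau>" using \<tau> by (intro real_le_rsqrt) (simp add: power2_eq_square mult_left_le)
  have e1: "2 * C / \<tau> \<le> 1 / \<tau>\<^sup>2"
  proof -
    have "\<tau> * (2 * C) \<le> sqrt \<tau> * (2 * C)"
      using root \<open>C \<ge> 0\<close> by (intro mult_right_mono) auto
    then show ?thesis using small \<tau> by (simp add: field_simps power2_eq_square)
  qed
  have e2: "C / \<tau> \<le> 1 / (\<tau> * sqrt \<tau>)"
  proof -
    have "sqrt \<tau> * C \<le> sqrt \<tau> * (2 * C)"
      using \<tau> \<open>C \<ge> 0\<close> by (intro mult_left_mono) auto
    then show ?thesis using small \<tau> by (simp add: field_simps)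
  qed
  have "entry_floor N n \<tau> \<le> logit_action N n Q r \<tau> i x j" if j: "j \<in> {1..n i}" for j
  proof -
    have "entry_floor N n \<tau> \<le> exp (- (C / \<tau>) - C / \<tau>) / M"
      unfolding entry_floor_def M_def[symmetric]
      using e1 M by (intro divide_right_mono) auto
    also have "\<dots> = exp (- (C / \<tau>)) * (exp (- (C / \<tau>)) / M)"
      by (simp add: exp_add[symmetric])
    also have "\<dots> \<le> exp (marginal N n Q r i j x / \<tau>) * (1 / Z)"
    proof (intro mult_mono Z')
      have "- C / \<tau> \<le> marginal N n Q r i j x / \<tau>"
        using C[OF j] \<tau> by (intro divide_right_mono) auto
      then show "exp (- (C / \<tau>)) \<le> exp (marginal N n Q r i j x / \<tau>)" by simp
    qed (use M in auto)
    also have "\<dots> = logit_action N n Q r \<tau> i x j"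
      using j by (simp add: logit_action_def Z_def)
    finally show ?thesis .
  qed
  moreover have "slack_floor N n \<tau> \<le> 1 - (\<Sum>j=1..n i. logit_action N n Q r \<tau> i x j)"
  proof -
    have "slack_floor N n \<tau> \<le> exp (- (C / \<tau>)) / M"
      unfolding slack_floor_def M_def[symmetric]
      using e2 M by (intro divide_right_mono) auto
    also have "\<dots> \<le> 1 / Z" by (rule Z')
    finally show ?thesis unfolding logit_action_slack Z_def .
  qed
  ultimately show ?thesis
    using \<tau> by (auto simp: restricted_actions_iff logit_action_def)
qed

section \<open>Common stationary points and equilibria\<close>

theorem lemma5:
  fixes N :: nat and n :: "nat \<Rightarrow> nat"
    and Q :: "nat \<Rightarrow> nat \<Rightarrow> nat \<Rightarrow> nat \<Rightarrow> real" and r :: "nat \<Rightarrow> nat \<Rightarrow> real"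
  assumes "N \<ge> 1" and "\<And>i. i \<in> {1..N} \<Longrightarrow> n i \<ge> 1"
  shows "\<exists>\<tau>\<^sub>0>0. \<forall>\<tau>. 0 < \<tau> \<and> \<tau> < \<tau>\<^sub>0 \<longrightarrow>
           common_stationary_points N n Q r \<tau> \<noteq> {} \<and>
           common_stationary_points N n Q r \<tau> =
             nash_equilibria N (transformed_actions n) (reg_utility N n Q r \<tau>)"
proof -
  let ?T = "PiE {1..N} (transformed_actions n)"
  obtain C where "C \<ge> 0"
    and C: "\<And>x i j. x \<in> ?T \<Longrightarrow> i \<in> {1..N} \<Longrightarrow> j \<in> {1..n i} \<Longrightarrow> \<bar>marginal N n Q r i j x\<bar> \<le> C"
    using marginal_bounded[of N n Q r] by blast
  show ?thesis
  \<comment> \<open>This threshold says \<open>sqrt \<tau> * (2 * C + 2) < 1\<close>, which covers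
    the smallness conditions of \<open>stationary_score_zero\<close> and
    \<open>logit_action_restricted\<close>.\<close>
  proof (intro exI[of _ "(1 / (2 * C + 2))\<^sup>2"] conjI allI impI)
    show "(1 / (2 * C + 2))\<^sup>2 > 0" using \<open>C \<ge> 0\<close> by simp
  next
    fix \<tau> :: real
    let ?X = "PiE {1..N} (restricted_actions N n \<tau>)"
    let ?NE = "nash_equilibria N (transformed_actions n) (reg_utility N n Q r \<tau>)"
    assume "0 < \<tau> \<and> \<tau> < (1 / (2 * C + 2))\<^sup>2"
    then have \<tau>0: "\<tau> > 0" and "sqrt \<tau> < 1 / (2 * C + 2)"
      using \<open>C \<ge> 0\<close> by (auto intro: real_less_lsqrt)
    then have small: "sqrt \<tau> * (2 * C + 2) < 1" using \<open>C \<ge> 0\<close> by (simp add: field_simps)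
    have root: "0 < sqrt \<tau>" "0 \<le> sqrt \<tau> * C" using \<tau>0 \<open>C \<ge> 0\<close> by auto
    have small1: "sqrt \<tau> * (C + 1) < 1" and small2: "sqrt \<tau> * (2 * C) \<le> 1"
      and "sqrt \<tau> \<le> 1"
      using small root by (simp_all add: algebra_simps del: real_sqrt_gt_0_iff real_sqrt_le_1_iff)
    from this(3) have \<tau>1: "\<tau> \<le> 1" by simp
    have NE: "?NE = {x \<in> ?T. \<forall>i\<in>{1..N}. x i = logit_action N n Q r \<tau> i x}"
      using nash_equilibria_eq_logit_fixed_points[OF \<tau>0] .
    have "common_stationary_points N n Q r \<tau> \<subseteq> ?NE"
    proof
      fix x assume x: "x \<in> common_stationary_points N n Q r \<tau>"
      then have st: "x \<in> stationary_points N n ?X (loss N n Q r \<tau> i j)"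
        if "i \<in> {1..N}" "j \<in> {1..n i}" for i j
        using that by (auto simp: common_stationary_points_def)
      \<comment> \<open>A common stationary point is only known to be restricted because there is
        at least one loss; otherwise the intersection defining the common stationary points would
        be the whole type.\<close>
      have "(1::nat) \<in> {1..N}" "(1::nat) \<in> {1..n 1}" using assms(1) assms(2)[of 1] by auto
      from st[OF this] have xX: "x \<in> ?X" by (simp add: stationary_points_def)
      have int: "interior_at n i x" "x i \<in> transformed_actions n i" if i: "i \<in> {1..N}" for i
        using restricted_action_interior[where x = x, OF i \<tau>0 PiE_mem[OF xX i]] .
      have xT: "x \<in> ?T"
        by (rule PiE_I) (use xX in \<open>auto intro: int(2) simp: PiE_def extensional_def\<close>)
      have "x i = logit_action N n Q r \<tau> i x" if i: "i \<in> {1..N}" for i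
      proof -
        have "x i \<in> extensional {1..n i}"
          using int(2)[OF i] by (simp add: transformed_actions_def)
        then show ?thesis
          using int(1)[OF i] stationary_score_zero[OF i _ \<tau>0 \<tau>1 st[OF i] C[OF xT i] small1]
          by (subst logit_iff_score_zero[OF \<tau>0]) auto
      qed
      then show "x \<in> ?NE" using xT unfolding NE by blast
    qed
    moreover have "?NE \<subseteq> common_stationary_points N n Q r \<tau>"
    proof
      fix x assume "x \<in> ?NE"
      then have xT: "x \<in> ?T" and logit: "\<And>i. i \<in> {1..N} \<Longrightarrow> x i = logit_action N n Q r \<tau> i x"
        unfolding NE by auto
      have "x i \<in> restricted_actions N n \<tau> i" if i: "i \<in> {1..N}" for i
        by (subst logit[OF i]) (rule logit_action_restricted[OF i \<tau>0 \<tau>1 \<open>C \<ge> 0\<close> C[OF xT i] small2])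
      then have xX: "x \<in> ?X" using xT by (auto simp: PiE_def)
      have "partial_deriv k m (loss N n Q r \<tau> i j) x = 0"
        if "i \<in> {1..N}" "j \<in> {1..n i}" "m \<in> {1..n k}" for i j k m
      proof -
        have "x i \<in> extensional {1..n i}"
          using PiE_mem[OF xT that(1)] by (simp add: transformed_actions_def)
        from logit_iff_score_zero[where x = x and n = n and i = i and N = N and Q = Q and r = r, OF \<tau>0 this]
          logit[OF that(1)] show ?thesis
          using that by (intro partial_deriv_loss_zero) auto
      qed
      then show "x \<in> common_stationary_points N n Q r \<tau>"
        using xX by (auto simp: common_stationary_points_def stationary_points_def)
    qed
    moreover have "?NE \<noteq> {}"
      using exists_logit_fixed_point[OF \<tau>0, of N n Q r] unfolding NE by blast
    ultimately show "common_stationary_points N n Q r \<tau> \<noteq> {}"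
      and "common_stationary_points N n Q r \<tau> = ?NE" by auto
  qed
qed

end
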